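(* Let $\varphi,\psi\colon G\to G$ be a tame pair of endomorphisms of a torsion-free nilpotent group $G$ of finite Prüfer rank, and let the Reidemeister coincidence zeta function $R_{\varphi,\psi}(z)$ be rational. Then one of the following two possibilities holds: (i) The sequence $\{R(\varphi^k,\psi^k)/\lambda(\varphi,\psi)^k\}_{k=1}^\infty$ has the same set of limit points as a periodic sequence $\big\{\sum_{j=1}^{n(\varphi,\psi)}\alpha_j\epsilon_j^k\big\}_{k=1}^\infty$, where $\alpha_j\in\mathbb{Z}$, $\epsilon_j\in\mathbb{C}$ and $\epsilon_j^q=1$ for some integer $q>0$. (ii) The set of limit points of the sequence $\{R(\varphi^k,\psi^k)/\lambda(\varphi,\psi)^k\}_{k=1}^\infty$ contains an interval.
   Context: For endomorphisms $\varphi,\psi$ of a group $G$, elements $\alpha,\beta\in G$ are $(\varphi,\psi)$-conjugate if $\beta=\psi(g)\,\alpha\,\varphi(g^{-1})$ for some $g\in G$; $R(\varphi,\psi)$ is the number of $(\varphi,\psi)$-conjugacy classes. The pair is tame if $R(\varphi^n,\psi^n)<\infty$ for all $n\in\mathbb{N}=\{1,2,\dots\}$. For a tame pair, $R_{\varphi,\psi}(z)=\exp\left(\sum_{k=1}^\infty\frac{R(\varphi^k,\psi^k)}{k}z^k\right)$. A group has finite Prüfer rank if there is an $r$ such that every finitely generated subgroup can be generated by at most $r$ elements. If $R_{\varphi,\psi}(z)$ is rational, then there are $r\in\mathbb{N}$, nonzero integers $\chi_1,\dots,\chi_r$ and distinct nonzero algebraic integers $\lambda_1,\dots,\lambda_r\in\mathbb{C}$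 (unique up to order; the $\lambda_i^{-1}$ are the zeros and poles of $R_{\varphi,\psi}$) such that $R(\varphi^k,\psi^k)=\sum_{i=1}^r\chi_i\lambda_i^k$ for every $k\in\mathbb{N}$. Define $\lambda(\varphi,\psi):=\max_i|\lambda_i|$ and $n(\varphi,\psi):=\#\{\lambda_i : |\lambda_i|=\lambda(\varphi,\psi)\}$. *)

theory Defs
  imports
    Complex_Main
    "HOL-Algebra.Generated_Groups"
    "HOL-Computational_Algebra.Polynomial_FPS"
begin

definition torsion_free :: "('a, 'b) monoid_scheme \<Rightarrow> bool" where
  "torsion_free G \<longleftrightarrow>
     (\<forall>x\<in>carrier G. \<forall>n::nat. n > 0 \<longrightarrow> x [^]\<^bsub>G\<^esub> n = \<one>\<^bsub>G\<^esub> \<longrightarrow> x = \<one>\<^bsub>G\<^esub>)"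

primrec lower_central :: "('a, 'b) monoid_scheme \<Rightarrow> nat \<Rightarrow> 'a set" where
  "lower_central G 0 = carrier G"
| "lower_central G (Suc n) =
     generate G {x \<otimes>\<^bsub>G\<^esub> y \<otimes>\<^bsub>G\<^esub> (inv\<^bsub>G\<^esub> x) \<otimes>\<^bsub>G\<^esub> (inv\<^bsub>G\<^esub> y) | x y.
                   x \<in> lower_central G n \<and> y \<in> carrier G}"

definition nilpotent_group :: "('a, 'b) monoid_scheme \<Rightarrow> bool" where
  "nilpotent_group G \<longleftrightarrow> group G \<and> (\<exists>n. lower_central G n = {\<one>\<^bsub>G\<^esub>})"

definition finite_pruefer_rank :: "('a, 'b) monoid_scheme \<Rightarrow> bool" where
  "finite_pruefer_rank G \<longleftrightarrow>
     (\<exists>r::nat. \<forall>S. finite S \<and> S \<subseteq> carrier G \<longrightarrow>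
        (\<exists>T. finite T \<and> T \<subseteq> carrier G \<and> card T \<le> r \<and> generate G T = generate G S))"

definition coincidence_conj ::
  "('a, 'b) monoid_scheme \<Rightarrow> ('a \<Rightarrow> 'a) \<Rightarrow> ('a \<Rightarrow> 'a) \<Rightarrow> ('a \<times> 'a) set" where
  "coincidence_conj G \<phi> \<psi> =
     {(\<alpha>, \<beta>). \<alpha> \<in> carrier G \<and> \<beta> \<in> carrier G \<and>
        (\<exists>g\<in>carrier G. \<beta> = \<psi> g \<otimes>\<^bsub>G\<^esub> \<alpha> \<otimes>\<^bsub>G\<^esub> \<phi> (inv\<^bsub>G\<^esub> g))}"

definition reidemeister_classes ::
  "('a, 'b) monoid_scheme \<Rightarrow> ('a \<Rightarrow> 'a) \<Rightarrow> ('a \<Rightarrow> 'a) \<Rightarrow> 'a set set" where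
  "reidemeister_classes G \<phi> \<psi> = carrier G // coincidence_conj G \<phi> \<psi>"

text \<open>The value is \<open>0\<close> if there are infinitely many classes; for a tame pair
  this does not happen for any pair of positive iterates.\<close>
definition reidemeister_number ::
  "('a, 'b) monoid_scheme \<Rightarrow> ('a \<Rightarrow> 'a) \<Rightarrow> ('a \<Rightarrow> 'a) \<Rightarrow> nat" where
  "reidemeister_number G \<phi> \<psi> = card (reidemeister_classes G \<phi> \<psi>)"

definition tame_pair ::
  "('a, 'b) monoid_scheme \<Rightarrow> ('a \<Rightarrow> 'a) \<Rightarrow> ('a \<Rightarrow> 'a) \<Rightarrow> bool" where
  "tame_pair G \<phi> \<psi> \<longleftrightarrow> (\<forall>n\<ge>1. finite (reidemeister_classes G (\<phi> ^^ n) (\<psi> ^^ n)))"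

text \<open>The zeta function is a formal power series over the complex numbers. The coefficient
  at \<open>k = 0\<close> of the series in the exponent is \<open>0\<close>, because \<open>x / 0 = 0\<close>.\<close>
definition reidemeister_zeta ::
  "('a, 'b) monoid_scheme \<Rightarrow> ('a \<Rightarrow> 'a) \<Rightarrow> ('a \<Rightarrow> 'a) \<Rightarrow> complex fps" where
  "reidemeister_zeta G \<phi> \<psi> =
     fps_compose (fps_exp 1)
       (Abs_fps (\<lambda>k. of_nat (reidemeister_number G (\<phi> ^^ k) (\<psi> ^^ k)) / of_nat k))"

definition rational_fps :: "complex fps \<Rightarrow> bool" where
  "rational_fps F \<longleftrightarrow> (\<exists>p q. q \<noteq> 0 \<and> fps_of_poly q * F = fps_of_poly p)"

text \<open>\<open>L\<close> is the set of the distinct numbers \<open>\<lambda>\<^sub>i\<close>, and \<open>\<chi> \<lambda>\<^sub>i\<close> is the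
  integer coefficient \<open>\<chi>\<^sub>i\<close>.\<close>
definition reidemeister_expansion ::
  "('a, 'b) monoid_scheme \<Rightarrow> ('a \<Rightarrow> 'a) \<Rightarrow> ('a \<Rightarrow> 'a) \<Rightarrow> complex set \<Rightarrow> (complex \<Rightarrow> int) \<Rightarrow> bool"
where
  "reidemeister_expansion G \<phi> \<psi> L \<chi> \<longleftrightarrow>
     finite L \<and> L \<noteq> {} \<and>
     (\<forall>l\<in>L. l \<noteq> 0 \<and> algebraic_int l \<and> \<chi> l \<noteq> 0) \<and>
     (\<forall>k\<ge>1. of_nat (reidemeister_number G (\<phi> ^^ k) (\<psi> ^^ k)) = (\<Sum>l\<in>L. of_int (\<chi> l) * l ^ k))"

text \<open>If the zeta function of a tame pair is rational, then such a set \<open>L\<close> exists and is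
  unique, its elements being the inverses of the zeros and poles of the zeta function. The
  definition is meaningful only in this situation.\<close>
definition reidemeister_lambdas ::
  "('a, 'b) monoid_scheme \<Rightarrow> ('a \<Rightarrow> 'a) \<Rightarrow> ('a \<Rightarrow> 'a) \<Rightarrow> complex set" where
  "reidemeister_lambdas G \<phi> \<psi> = (THE L. \<exists>\<chi>. reidemeister_expansion G \<phi> \<psi> L \<chi>)"

definition lambda_max ::
  "('a, 'b) monoid_scheme \<Rightarrow> ('a \<Rightarrow> 'a) \<Rightarrow> ('a \<Rightarrow> 'a) \<Rightarrow> real" where
  "lambda_max G \<phi> \<psi> = Max (cmod ` reidemeister_lambdas G \<phi> \<psi>)"

definition lambda_max_count ::
  "('a, 'b) monoid_scheme \<Rightarrow> ('a \<Rightarrow> 'a) \<Rightarrow> ('a \<Rightarrow> 'a) \<Rightarrow> nat" where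
  "lambda_max_count G \<phi> \<psi> =
     card {l \<in> reidemeister_lambdas G \<phi> \<psi>. cmod l = lambda_max G \<phi> \<psi>}"

text \<open>Limit points of a sequence are the limits of its convergent subsequences, so a value
  attained infinitely often counts. This differs from the limit points of the range.\<close>
definition seq_limit_points :: "(nat \<Rightarrow> 'a::topological_space) \<Rightarrow> 'a set" where
  "seq_limit_points X = {l. \<exists>r. strict_mono r \<and> (X \<circ> r) \<longlonglongrightarrow> l}"

text \<open>The normalised sequence starts at the first iterates: its term at index \<open>k\<close> belongs
  to \<open>Suc k\<close>.\<close>
definition reidemeister_ratio ::
  "('a, 'b) monoid_scheme \<Rightarrow> ('a \<Rightarrow> 'a) \<Rightarrow> ('a \<Rightarrow> 'a) \<Rightarrow> nat \<Rightarrow> real" where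
  "reidemeister_ratio G \<phi> \<psi> k =
     real (reidemeister_number G (\<phi> ^^ Suc k) (\<psi> ^^ Suc k)) / lambda_max G \<phi> \<psi> ^ Suc k"

end

theory Submission
  imports Defs
    "HOL-Analysis.Kronecker_Approximation_Theorem"
    "HOL-Computational_Algebra.Fundamental_Theorem_Algebra"
begin

text \<open>
  Write \<open>a\<^sub>k\<close> for the Reidemeister number of the \<open>k\<close>-th iterates. The logarithmic derivative of a
  rational function turns its zeros and poles into a signed power sum, so rationality of the zeta
  function gives \<open>a\<^sub>k = \<Sum> m(\<lambda>) \<lambda>\<^sup>k\<close> with integer multiplicities \<open>m(\<lambda>)\<close>
  (\<open>rational_exp_int_power_sum\<close>). The \<open>\<lambda>\<close> are algebraic integers because the \<open>a\<^sub>k\<close> are integers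
  (\<open>algebraic_int_if_power_sums_int\<close>), and they are determined by the sequence because distinct
  geometric sequences are linearly independent. Hence the set of the \<open>\<lambda>\<close> that the statement
  refers to by a definite description really is the set just found
  (\<open>reidemeister_expansion_lambdas\<close>).

  Divide by the \<open>k\<close>-th power of the largest modulus \<open>\<rho>\<close>. The terms with \<open>|\<lambda>| < \<rho>\<close> tend to \<open>0\<close>
  and do not affect limit points, which leaves an exponential sum \<open>s\<^sub>k = \<Sum> m(\<lambda>) (\<lambda>/\<rho>)\<^sup>k\<close> with
  frequencies on the unit circle. If all of them are roots of unity, \<open>s\<close> is periodic and the first
  alternative holds.

  Otherwise some frequency \<open>\<nu>\<close> has infinite order, and the limit points contain an interval
  (\<open>limit_points_exponential_sum_contain_interval\<close>). Restrict the sequence to a progression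
  \<open>a + Nj\<close>, where \<open>N\<close> is divisible by the orders of all roots of unity among the frequencies
  and among their quotients by \<open>\<nu>\<close>. Along every such progression the sequence has the same mean
  \<open>M\<close>, and its correlation with \<open>\<nu>\<^sup>-\<^sup>N\<^sup>j\<close> has the same value \<open>C\<close>; for a suitable offset \<open>a\<close> we have
  \<open>C \<noteq> 0\<close>. A real sequence that correlates in this way with a unimodular one must exceed its mean
  by more than \<open>|C|/3\<close> infinitely often, and fall below it by more than \<open>|C|/3\<close> infinitely often
  (\<open>frequently_above_mean\<close>, \<open>frequently_below_mean\<close>). By Dirichlet's theorem \<open>N\<close> can
  moreover be chosen so that all \<open>N\<close>-th powers of the frequencies are as close to \<open>1\<close> as
  desired (\<open>simultaneous_near_1\<close>); then consecutive terms of the progression differ by little, so on the way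
  from one side of the mean to the other the sequence comes close to every value in between.
\<close>

section \<open>Power sums\<close>

text \<open>This is the nonvanishing of the Vandermonde determinant. Pairing the relations with the
  coefficients of the polynomial of degree \<open>card S - 1\<close> that vanishes on \<open>S - {w}\<close> isolates the
  coefficient at \<open>w\<close>.\<close>

lemma power_sum_eq_0_imp_coeff_0:
  fixes b :: "'a::idom \<Rightarrow> 'a"
  assumes "finite S" and zero: "\<And>k. k < card S \<Longrightarrow> (\<Sum>z\<in>S. b z * z ^ k) = 0" and "w \<in> S"
  shows "b w = 0"
proof -
  define p where "p = (\<Prod>z\<in>S - {w}. [:-z, 1:])"
  have deg: "degree p < card S"
  proof -
    have "degree p \<le> (\<Sum>z\<in>S - {w}. degree [:-z, 1:])"
      unfolding p_def using degree_prod_sum_le[of "S - {w}" "\<lambda>z. [:-z, 1:]"] assms(1) by (simp add: o_def)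
    also have "\<dots> < card S"
      using card_Diff1_less[OF assms(1,3)] by simp
    finally show ?thesis .
  qed
  have "(\<Sum>z\<in>S. b z * poly p z) = (\<Sum>z\<in>S. \<Sum>k\<le>degree p. coeff p k * (b z * z ^ k))"
    by (simp add: poly_altdef sum_distrib_left mult_ac)
  also have "\<dots> = (\<Sum>k\<le>degree p. coeff p k * (\<Sum>z\<in>S. b z * z ^ k))"
    by (subst sum.swap) (simp add: sum_distrib_left)
  also have "\<dots> = 0"
    using zero deg by (intro sum.neutral) auto
  finally have "(\<Sum>z\<in>S. b z * poly p z) = 0" .
  moreover have "(\<Sum>z\<in>S. b z * poly p z) = b w * poly p w"
  proof -
    have "poly p z = 0" if "z \<in> S - {w}" for z
      using that assms(1) by (auto simp: p_def poly_prod)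
    then show ?thesis
      using assms(1,3) by (simp add: sum.remove[of S w])
  qed
  moreover have "poly p w \<noteq> 0"
    using assms(1) by (auto simp: p_def poly_prod)
  ultimately show ?thesis by simp
qed

text \<open>
  A form of Fatou's lemma on rational power series with integer coefficients, proved by the
  pigeonhole principle. Let \<open>a\<close> be the integer sequence and \<open>n = card S\<close>. Reducing \<open>x\<^sup>k\<close> modulo
  \<open>\<Prod> (x - z)\<close> writes the \<open>k\<close>-th shift of \<open>a\<close> as a real combination of the shifts by less
  than \<open>n\<close>. Subtracting the integer parts of the coefficients leaves an integer sequence whose
  first \<open>n\<close> entries are bounded independently of \<open>k\<close>. Hence two different shifts leave the same
  entries, and this coincidence is a monic integer polynomial that vanishes on \<open>S\<close>.
\<close>

lemma algebraic_int_if_power_sums_int: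
  fixes c :: "complex \<Rightarrow> complex"
  assumes fin: "finite S" and c: "\<And>z. z \<in> S \<Longrightarrow> c z \<noteq> 0"
    and int: "\<And>k. (\<Sum>z\<in>S. c z * z ^ k) \<in> \<int>" and "w \<in> S"
  shows "algebraic_int w"
proof -
  define n where "n = card S"
  define P where "P = (\<Prod>z\<in>S. [:-z, 1:])"
  have P0: "P \<noteq> 0" unfolding P_def using fin by auto
  have degP: "degree P = n"
    unfolding P_def n_def using fin by (subst degree_prod_eq_sum_degree) auto
  have n0: "n > 0" using fin \<open>w \<in> S\<close> by (auto simp: n_def card_gt_0_iff)
  obtain a :: "nat \<Rightarrow> int" where a: "\<And>k. (\<Sum>z\<in>S. c z * z ^ k) = of_int (a k)"
    using int unfolding Ints_def image_iff by metis
  define R where "R k = monom 1 k mod P" for k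
  have degR: "degree (R k) < n" for k
    using degree_mod_less'[of P "monom 1 k"] P0 degP n0 unfolding R_def
    by (cases "monom 1 k mod P = 0") auto
  have R: "poly (R k) z = (\<Sum>j<n. coeff (R k) j * z ^ j)" for k z
    using degR[of k] unfolding poly_altdef
    by (intro sum.mono_neutral_left) (auto simp: coeff_eq_0)
  have Rz: "poly (R k) z = z ^ k" if "z \<in> S" for k z
  proof -
    have "poly P z = 0" using that fin by (auto simp: P_def poly_prod)
    moreover have "poly (monom 1 k div P * P + monom 1 k mod P) z = poly (monom 1 k) z"
      by (simp only: div_mult_mod_eq)
    ultimately have "poly (monom 1 k mod P) z = poly (monom 1 k) z"
      unfolding poly_add poly_mult by simp
    then show ?thesis by (simp add: R_def poly_monom)
  qed
  \<comment> \<open>Since \<open>a\<close> is real, the coefficients of the remainder may be replaced by their real parts.\<close>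
  define r where "r k j = Re (coeff (R k) j)" for k j
  have shift: "real_of_int (a (i + k)) = (\<Sum>j<n. r k j * real_of_int (a (i + j)))" for i k
  proof -
    have "complex_of_int (a (i + k)) = (\<Sum>z\<in>S. c z * z ^ i * poly (R k) z)"
      unfolding a[symmetric] by (intro sum.cong) (auto simp: Rz power_add)
    also have "\<dots> = (\<Sum>z\<in>S. \<Sum>j<n. coeff (R k) j * (c z * z ^ (i + j)))"
      by (simp add: R sum_distrib_left power_add mult_ac)
    also have "\<dots> = (\<Sum>j<n. coeff (R k) j * of_int (a (i + j)))"
      by (subst sum.swap) (simp add: sum_distrib_left a[symmetric])
    finally have "Re (of_int (a (i + k))) = Re (\<Sum>j<n. coeff (R k) j * of_int (a (i + j)))"
      by (rule arg_cong)
    then show ?thesis by (simp add: r_def)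
  qed
  \<comment> \<open>\<open>u k\<close> is the \<open>k\<close>-th shift minus the integer parts of its coefficients. It takes integer
     values, and the bound comes from the fractional parts that are left.\<close>
  define u where "u k i = a (i + k) - (\<Sum>j<n. \<lfloor>r k j\<rfloor> * a (i + j))" for k i
  define B where "B = (\<Sum>i<n. \<Sum>j<n. \<bar>a (i + j)\<bar>)"
  have u_bound: "\<bar>u k i\<bar> \<le> B" if "i < n" for k i
  proof -
    have "real_of_int (u k i) = (\<Sum>j<n. frac (r k j) * real_of_int (a (i + j)))"
      by (simp add: u_def shift[of i k] frac_def left_diff_distrib sum_subtractf)
    also have "\<bar>\<dots>\<bar> \<le> (\<Sum>j<n. 1 * \<bar>real_of_int (a (i + j))\<bar>)"
      by (intro order.trans[OF sum_abs] sum_mono)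
        (simp add: abs_mult frac_ge_0 less_imp_le[OF frac_lt_1] mult_left_le_one_le)
    also have "\<dots> = real_of_int (\<Sum>j<n. \<bar>a (i + j)\<bar>)" by simp
    finally have "\<bar>u k i\<bar> \<le> (\<Sum>j<n. \<bar>a (i + j)\<bar>)" by linarith
    also have "\<dots> \<le> B"
      unfolding B_def using that by (intro member_le_sum[of i "{..<n}"]) (auto intro: sum_nonneg)
    finally show ?thesis .
  qed
  define U where "U k = restrict (u k) {..<n}" for k
  \<comment> \<open>Only \<open>k \<ge> n\<close> is considered, so that \<open>x\<^sup>k\<close> stays the leading term of \<open>W\<close> below.\<close>
  have "U ` {n..} \<subseteq> PiE {..<n} (\<lambda>_. {-B..B})"
  proof (clarsimp simp: U_def)
    fix k i assume "i < n"
    then show "- B \<le> u k i \<and> u k i \<le> B" using u_bound[of i k] by linarith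
  qed
  then have "finite (U ` {n..})"
    by (rule finite_subset) (auto intro: finite_PiE)
  moreover have "infinite {n..}" by (rule infinite_Ici)
  ultimately have "\<not> inj_on U {n..}"
    using finite_image_iff by blast
  then obtain x y where "n \<le> x" "n \<le> y" "x \<noteq> y" "U x = U y"
    by (auto simp: inj_on_def)
  then obtain m k where mk: "n \<le> m" "m < k" "U k = U m"
    using that[of x y] that[of y x] by (cases "x < y") simp_all
  have u_eq: "u k i = u m i" if "i < n" for i
    using fun_cong[OF mk(3), of i] that by (simp add: U_def)
  define e where "e j = \<lfloor>r k j\<rfloor> - \<lfloor>r m j\<rfloor>" for j
  define V where "V = monom 1 m + (\<Sum>j<n. monom (of_int (e j)) j :: complex poly)"
  define W where "W = monom 1 k - V"
  have degV: "degree V < k"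
  proof -
    have "degree (\<Sum>j<n. monom (of_int (e j)) j :: complex poly) < k"
      using mk n0 by (intro degree_sum_less) (auto intro: le_less_trans[OF degree_monom_le])
    moreover have "degree (monom (1::complex) m) < k" using mk by (simp add: degree_monom_eq)
    ultimately show ?thesis unfolding V_def by (intro degree_add_less)
  qed
  then have "degree W = k"
    unfolding W_def using degree_add_eq_left[of "- V" "monom 1 k"] by (simp add: degree_monom_eq)
  then have lead: "lead_coeff W = 1"
    using degV by (simp add: W_def coeff_eq_0)
  have W_int: "coeff W i \<in> \<int>" for i
    unfolding W_def V_def coeff_diff coeff_add coeff_sum coeff_monom
    by (intro Ints_diff Ints_add Ints_sum) simp_all
  have Wz: "poly W z = z ^ k - z ^ m - (\<Sum>j<n. of_int (e j) * z ^ j)" for z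
    unfolding W_def V_def by (simp add: poly_sum poly_monom)
  \<comment> \<open>Agreement in the first \<open>n\<close> entries suffices, by the Vandermonde argument.\<close>
  have "c w * poly W w = 0"
  proof (rule power_sum_eq_0_imp_coeff_0[of S "\<lambda>z. c z * poly W z"])
    fix i assume "i < card S"
    then have i: "i < n" by (simp add: n_def)
    have "(\<Sum>z\<in>S. c z * poly W z * z ^ i)
        = (\<Sum>z\<in>S. c z * z ^ (i + k) - c z * z ^ (i + m) - (\<Sum>j<n. of_int (e j) * (c z * z ^ (i + j))))"
      by (intro sum.cong refl) (simp add: Wz ring_distribs sum_distrib_left sum_distrib_right power_add mult_ac)
    also have "\<dots> = (\<Sum>z\<in>S. c z * z ^ (i + k)) - (\<Sum>z\<in>S. c z * z ^ (i + m))
          - (\<Sum>z\<in>S. \<Sum>j<n. of_int (e j) * (c z * z ^ (i + j)))"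
      by (simp only: sum_subtractf)
    also have "(\<Sum>z\<in>S. \<Sum>j<n. of_int (e j) * (c z * z ^ (i + j))) = (\<Sum>j<n. of_int (e j) * (\<Sum>z\<in>S. c z * z ^ (i + j)))"
      by (subst sum.swap) (simp only: sum_distrib_left)
    also have "(\<Sum>z\<in>S. c z * z ^ (i + k)) - (\<Sum>z\<in>S. c z * z ^ (i + m)) - \<dots> = of_int (u k i - u m i)"
      unfolding a by (simp add: u_def e_def left_diff_distrib sum_subtractf)
    finally show "(\<Sum>z\<in>S. c z * poly W z * z ^ i) = 0"
      using u_eq[OF i] by simp
  qed (use fin \<open>w \<in> S\<close> in auto)
  then show ?thesis
    using c[OF \<open>w \<in> S\<close>] algebraic_int.intros[OF lead] W_int by simp
qed

lemma power_sum_unique: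
  fixes L M :: "'a::{idom, ring_char_0} set"
  assumes "finite L" "finite M" "0 \<notin> L" "0 \<notin> M"
    and "\<And>l. l \<in> L \<Longrightarrow> m l \<noteq> 0" "\<And>l. l \<in> M \<Longrightarrow> m' l \<noteq> 0"
    and eq: "\<And>k. k \<ge> 1 \<Longrightarrow> (\<Sum>l\<in>L. of_int (m l) * l ^ k) = (\<Sum>l\<in>M. of_int (m' l) * l ^ k)"
  shows "L = M"
proof -
  define d where "d l = ((if l \<in> L then of_int (m l) else 0) - (if l \<in> M then of_int (m' l) else 0)) * l" for l
  have "d l = 0" if "l \<in> L \<union> M" for l
  proof (rule power_sum_eq_0_imp_coeff_0[of "L \<union> M" d])
    fix k
    have "(\<Sum>l\<in>L \<union> M. (if l \<in> L then of_int (m l) else 0) * l ^ Suc k) = (\<Sum>l\<in>L. of_int (m l) * l ^ Suc k)"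
      using assms(1,2) by (intro sum.mono_neutral_cong_right) auto
    moreover have "(\<Sum>l\<in>L \<union> M. (if l \<in> M then of_int (m' l) else 0) * l ^ Suc k) = (\<Sum>l\<in>M. of_int (m' l) * l ^ Suc k)"
      using assms(1,2) by (intro sum.mono_neutral_cong_right) auto
    ultimately show "(\<Sum>l\<in>L \<union> M. d l * l ^ k) = 0"
      using eq[of "Suc k"] by (simp add: d_def algebra_simps sum_subtractf)
  qed (use assms that in auto)
  then show ?thesis
    using assms(3-6) by (fastforce simp: d_def split: if_splits)
qed

section \<open>Rational exponentials and signed power sums\<close>

text \<open>The exponent starts at \<open>1\<close>, as in a logarithmic derivative; so \<open>l = 0\<close> never contributes.\<close>

definition int_power_sum :: "(nat \<Rightarrow> 'a::ring_1) \<Rightarrow> bool" where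
  "int_power_sum s \<longleftrightarrow>
     (\<exists>L m. finite L \<and> (\<forall>l\<in>L. l \<noteq> 0 \<and> m l \<noteq> 0) \<and> (\<forall>k. s k = (\<Sum>l\<in>L. of_int (m l) * l ^ Suc k)))"

lemma int_power_sum_I:
  assumes "finite L" "\<And>k. s k = (\<Sum>l\<in>L. of_int (m l) * l ^ Suc k)"
  shows "int_power_sum s"
proof -
  let ?L = "{l \<in> L. l \<noteq> 0 \<and> m l \<noteq> 0}"
  have "s k = (\<Sum>l\<in>?L. of_int (m l) * l ^ Suc k)" for k
    unfolding assms(2) using assms(1) by (intro sum.mono_neutral_right) auto
  then show ?thesis
    unfolding int_power_sum_def using assms(1) by (intro exI[of _ ?L] exI[of _ m]) auto
qed

lemma int_power_sum_diff:
  assumes "int_power_sum s" "int_power_sum t"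
  shows "int_power_sum (\<lambda>k. s k - t k)"
proof -
  obtain L m where L: "finite L" "\<And>k. s k = (\<Sum>l\<in>L. of_int (m l) * l ^ Suc k)"
    using assms(1) unfolding int_power_sum_def by blast
  obtain M m' where M: "finite M" "\<And>k. t k = (\<Sum>l\<in>M. of_int (m' l) * l ^ Suc k)"
    using assms(2) unfolding int_power_sum_def by blast
  let ?\<theta> = "\<lambda>l. (if l \<in> L then m l else 0) - (if l \<in> M then m' l else 0)"
  show ?thesis
  proof (rule int_power_sum_I[of "L \<union> M" _ ?\<theta>])
    fix k
    have "s k = (\<Sum>l\<in>L \<union> M. of_int (if l \<in> L then m l else 0) * l ^ Suc k)"
      unfolding L(2) using L(1) M(1) by (intro sum.mono_neutral_cong_left) auto
    moreover have "t k = (\<Sum>l\<in>L \<union> M. of_int (if l \<in> M then m' l else 0) * l ^ Suc k)"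
      unfolding M(2) using L(1) M(1) by (intro sum.mono_neutral_cong_left) auto
    ultimately show "s k - t k = (\<Sum>l\<in>L \<union> M. of_int (?\<theta> l) * l ^ Suc k)"
      by (simp add: left_diff_distrib sum_subtractf)
  qed (use L M in auto)
qed

text \<open>A factor \<open>x - r\<close> contributes \<open>1 / (x - r) = - \<Sum>\<^sub>k r\<^sup>-\<^sup>(\<^sup>k\<^sup>+\<^sup>1\<^sup>) x\<^sup>k\<close> to the logarithmic
  derivative \<open>p' / p\<close>. The equation is multiplied out to avoid division of power series.\<close>

lemma log_deriv_poly_int_power_sum:
  fixes p :: "complex poly"
  assumes "poly p 0 \<noteq> 0"
  shows "\<exists>s. int_power_sum s \<and> fps_of_poly (pderiv p) = - (fps_of_poly p * Abs_fps s)"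
  using assms
proof (induction "degree p" arbitrary: p)
  case 0
  have "int_power_sum (\<lambda>_. 0 :: complex)"
    by (rule int_power_sum_I[of "{}"]) auto
  moreover have "pderiv p = 0" using 0 by (simp add: pderiv_eq_0_iff)
  moreover have "Abs_fps (\<lambda>_. 0 :: complex) = 0" by (simp add: fps_eq_iff)
  ultimately show ?case by (intro exI[of _ "\<lambda>_. 0"]) auto
next
  case (Suc d)
  then obtain r where r: "poly p r = 0"
    using fundamental_theorem_of_algebra[of p] by (metis constant_degree nat.distinct(1))
  then obtain q where q: "p = [:-r, 1:] * q"
    by (auto simp: poly_eq_0_iff_dvd elim: dvdE)
  have r0: "r \<noteq> 0" and q0: "poly q 0 \<noteq> 0" using Suc.prems unfolding q by auto
  have "q \<noteq> 0" using q0 by auto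
  then have "d = degree q" using Suc.hyps(2) unfolding q by (subst (asm) degree_mult_eq) auto
  then obtain s where s: "int_power_sum s" "fps_of_poly (pderiv q) = - (fps_of_poly q * Abs_fps s)"
    using Suc.hyps(1)[OF _ q0] by auto
  define g where "g = Abs_fps (\<lambda>k. inverse r ^ Suc k)"
  have geo: "fps_of_poly [:-r, 1:] * g = -1"
  proof (rule fps_ext)
    fix k
    show "fps_nth (fps_of_poly [:-r, 1:] * g) k = fps_nth (-1) k"
      unfolding fps_of_poly_linear using r0
      by (cases k) (simp_all add: g_def algebra_simps)
  qed
  have "int_power_sum (\<lambda>k. - (inverse r ^ Suc k))"
    by (rule int_power_sum_I[of "{inverse r}" _ "\<lambda>_. -1"]) auto
  from int_power_sum_diff[OF s(1) this]
  have t: "int_power_sum (\<lambda>k. s k + inverse r ^ Suc k)" by simp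
  have sum: "Abs_fps (\<lambda>k. s k + inverse r ^ Suc k) = Abs_fps s + g"
    by (simp add: g_def fps_eq_iff)
  have "pderiv p = q + [:-r, 1:] * pderiv q"
    unfolding q by (simp only: pderiv_mult) (simp add: pderiv_pCons)
  then have "fps_of_poly (pderiv p)
      = fps_of_poly q + fps_of_poly [:-r, 1:] * fps_of_poly (pderiv q)"
    by (simp only: fps_of_poly_add fps_of_poly_mult)
  also have "\<dots> = - (fps_of_poly [:-r, 1:] * g) * fps_of_poly q - fps_of_poly [:-r, 1:] * (fps_of_poly q * Abs_fps s)"
    unfolding geo s(2) by simp
  also have "\<dots> = - (fps_of_poly p * (Abs_fps s + g))"
    unfolding q fps_of_poly_mult by (simp add: algebra_simps)
  finally show ?case using t sum by metis
qed

text \<open>A factor \<open>x\<close> of the denominator also divides the numerator and cancels.\<close>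

lemma rational_fps_denom_nonzero_at_0:
  assumes "rational_fps F"
  shows "\<exists>p q. poly q 0 \<noteq> 0 \<and> fps_of_poly q * F = fps_of_poly p"
proof -
  have "\<exists>p' q'. poly q' 0 \<noteq> 0 \<and> fps_of_poly q' * F = fps_of_poly p'"
    if "q \<noteq> 0" "fps_of_poly q * F = fps_of_poly p" for p q
    using that
  proof (induction "degree q" arbitrary: p q rule: less_induct)
    case less
    show ?case
    proof (cases "poly q 0 = 0")
      case True
      then obtain q' where q': "q = pCons 0 q'" by (cases q) auto
      have "coeff p 0 = fps_nth (fps_of_poly q * F) 0" using less.prems(2) by simp
      also have "\<dots> = 0" using q' by simp
      finally obtain p' where p': "p = pCons 0 p'" by (cases p) auto
      have "fps_of_poly q' * F = fps_of_poly p'"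
        using less.prems(2) unfolding q' p' by (simp add: fps_of_poly_pCons mult.assoc)
      moreover have "q' \<noteq> 0" using less.prems(1) q' by auto
      ultimately show ?thesis using less.hyps[of q' p'] q' by simp
    qed (use less.prems in auto)
  qed
  then show ?thesis using assms unfolding rational_fps_def by blast
qed

text \<open>The coefficients of the derivative of the exponent are the \<open>a (Suc k)\<close>; this derivative
  is the logarithmic derivative of the exponential, here a quotient \<open>p / q\<close>, hence \<open>p' / p - q' / q\<close>.\<close>

lemma rational_exp_int_power_sum:
  fixes a :: "nat \<Rightarrow> complex"
  assumes "rational_fps (fps_exp 1 oo Abs_fps (\<lambda>k. a k / of_nat k))" (is "rational_fps ?F")
  shows "int_power_sum (\<lambda>k. a (Suc k))"
proof -
  let ?A = "Abs_fps (\<lambda>k. a k / of_nat k)"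
  let ?D = "Abs_fps (\<lambda>k. a (Suc k))"
  obtain p q where q0: "poly q 0 \<noteq> 0" and pq: "fps_of_poly q * ?F = fps_of_poly p"
    using rational_fps_denom_nonzero_at_0[OF assms] by blast
  have "coeff p 0 = coeff q 0 * fps_nth ?F 0"
    using arg_cong[OF pq, of "\<lambda>f. fps_nth f 0"] by simp
  then have p0: "poly p 0 \<noteq> 0" using q0 by (simp add: poly_0_coeff_0)
  have "fps_deriv ?A = ?D"
    by (rule fps_ext) (simp add: field_simps del: of_nat_Suc)
  then have dF: "fps_deriv ?F = ?F * ?D"
    by (subst fps_compose_deriv) simp_all
  obtain s where s: "int_power_sum s" "fps_of_poly (pderiv p) = - (fps_of_poly p * Abs_fps s)"
    using log_deriv_poly_int_power_sum[OF p0] by blast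
  obtain t where t: "int_power_sum t" "fps_of_poly (pderiv q) = - (fps_of_poly q * Abs_fps t)"
    using log_deriv_poly_int_power_sum[OF q0] by blast
  have "fps_of_poly (pderiv p) = fps_of_poly (pderiv q) * ?F + fps_of_poly q * (?F * ?D)"
    unfolding fps_of_poly_pderiv pq[symmetric] by (simp add: dF)
  also have "\<dots> = fps_of_poly p * (?D - Abs_fps t)"
    unfolding t(2) pq[symmetric] by (simp add: algebra_simps)
  finally have "fps_of_poly p * (?D - Abs_fps t + Abs_fps s) = 0"
    unfolding s(2) by (simp add: algebra_simps)
  moreover have "fps_of_poly p \<noteq> 0" using p0 by auto
  ultimately have "?D - Abs_fps t + Abs_fps s = 0" by (simp only: mult_eq_0_iff) simp
  then have "?D = Abs_fps t - Abs_fps s" by (simp add: algebra_simps)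
  then have "(\<lambda>k. a (Suc k)) = (\<lambda>k. t k - s k)"
    by (auto simp: fps_eq_iff)
  then show ?thesis using int_power_sum_diff[OF t(1) s(1)] by simp
qed

section \<open>Limit points of sequences\<close>

lemma seq_limit_points_I:
  fixes x :: "nat \<Rightarrow> 'a::metric_space"
  assumes "\<And>\<delta>. \<delta> > 0 \<Longrightarrow> \<exists>\<^sub>\<infinity>k. dist (x k) e < \<delta>"
  shows "e \<in> seq_limit_points x"
proof -
  have "\<exists>k. m < k \<and> dist (x k) e < inverse (real (Suc n))" for m n
    using assms[of "inverse (real (Suc n))"] unfolding INFM_nat by auto
  then have "\<exists>r. \<forall>n. dist (x (r n)) e < inverse (real (Suc n)) \<and> r n < r (Suc n)"
    by (intro dependent_nat_choice) blast+
  then obtain r where r: "\<And>n. dist (x (r n)) e < inverse (real (Suc n))" "\<And>n. r n < r (Suc n)"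
    by blast
  have "(\<lambda>n. dist ((x \<circ> r) n) e) \<longlonglongrightarrow> 0"
    using r(1)
    by (intro tendsto_sandwich[OF _ _ tendsto_const LIMSEQ_inverse_real_of_nat])
      (auto intro!: always_eventually simp: less_imp_le simp del: of_nat_Suc)
  then have "(x \<circ> r) \<longlonglongrightarrow> e" by (simp only: tendsto_dist_iff[symmetric])
  moreover have "strict_mono r" using r(2) by (simp add: strict_mono_Suc_iff)
  ultimately show ?thesis unfolding seq_limit_points_def by blast
qed

lemma seq_limit_points_cong:
  fixes x y :: "nat \<Rightarrow> 'a::real_normed_vector"
  assumes "(\<lambda>k. x k - y k) \<longlonglongrightarrow> 0"
  shows "seq_limit_points x = seq_limit_points y"
proof -
  have "(x \<circ> r) \<longlonglongrightarrow> l \<longleftrightarrow> (y \<circ> r) \<longlonglongrightarrow> l" if "strict_mono r" for r l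
  proof -
    have d: "(\<lambda>k. (x \<circ> r) k - (y \<circ> r) k) \<longlonglongrightarrow> 0"
      using LIMSEQ_subseq_LIMSEQ[OF assms that] by (simp add: o_def)
    show ?thesis
    proof
      assume "(x \<circ> r) \<longlonglongrightarrow> l"
      from tendsto_diff[OF this d] show "(y \<circ> r) \<longlonglongrightarrow> l" by (simp add: o_def)
    next
      assume "(y \<circ> r) \<longlonglongrightarrow> l"
      from tendsto_add[OF this d] show "(x \<circ> r) \<longlonglongrightarrow> l" by (simp add: o_def)
    qed
  qed
  then show ?thesis unfolding seq_limit_points_def by blast
qed

text \<open>A discrete intermediate value theorem: steps shorter than \<open>\<delta>\<close> cannot jump over the
  \<open>\<delta>\<close>-neighbourhood of \<open>e\<close>.\<close>

lemma crossing_frequently_near: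
  fixes y :: "nat \<Rightarrow> real"
  assumes steps: "\<forall>\<^sub>F j in sequentially. \<bar>y (Suc j) - y j\<bar> < \<delta>"
    and below: "\<exists>\<^sub>\<infinity>j. y j < e" and above: "\<exists>\<^sub>\<infinity>j. e < y j"
  shows "\<exists>\<^sub>\<infinity>j. \<bar>y j - e\<bar> < \<delta>"
  unfolding INFM_nat
proof
  fix m
  obtain J where J: "\<And>j. j \<ge> J \<Longrightarrow> \<bar>y (Suc j) - y j\<bar> < \<delta>"
    using steps unfolding eventually_sequentially by blast
  obtain p where p: "p > max m J" "y p < e" using below unfolding INFM_nat by blast
  obtain q where q: "q > p" "e < y q" using above unfolding INFM_nat by blast
  obtain t where t: "t \<ge> p" "t < q" "y t < e" "e \<le> y (Suc t)"
  proof -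
    have "\<exists>t\<ge>p. t < q' \<and> y t < e \<and> e \<le> y (Suc t)" if "p < q'" "e \<le> y q'" for q'
      using that
    proof (induction q')
      case (Suc q')
      show ?case
      proof (cases "y q' < e")
        case True
        then show ?thesis using Suc.prems by (intro exI[of _ q']) auto
      next
        case False
        then have "p < q'" using Suc.prems p(2) by (metis less_antisym)
        then show ?thesis using Suc.IH False by (meson less_SucI not_less)
      qed
    qed simp
    then show ?thesis using that q by (meson less_imp_le)
  qed
  have "\<bar>y t - e\<bar> < \<delta>" using J[of t] t p by auto
  then show "\<exists>n>m. \<bar>y n - e\<bar> < \<delta>" using t p by (intro exI[of _ t]) auto
qed

section \<open>Mean values\<close>

text \<open>Convergence of the Cesaro means.\<close>

definition has_mean :: "(nat \<Rightarrow> 'a::real_normed_field) \<Rightarrow> 'a \<Rightarrow> bool" where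
  "has_mean f M \<longleftrightarrow> (\<lambda>n. (\<Sum>j<n. f j) / of_nat n) \<longlonglongrightarrow> M"

lemma has_mean_const: "has_mean (\<lambda>_. c) c"
proof -
  have "\<forall>\<^sub>F n in sequentially. (\<Sum>j<n. c) / of_nat n = c"
    using eventually_gt_at_top[of 0] by eventually_elim simp
  then show ?thesis unfolding has_mean_def by (rule tendsto_eventually)
qed

lemma has_mean_add: "has_mean f M \<Longrightarrow> has_mean g N \<Longrightarrow> has_mean (\<lambda>j. f j + g j) (M + N)"
  unfolding has_mean_def by (simp add: sum.distrib add_divide_distrib tendsto_add)

lemma has_mean_cmult: "has_mean f M \<Longrightarrow> has_mean (\<lambda>j. c * f j) (c * M)"
  unfolding has_mean_def sum_distrib_left[symmetric] times_divide_eq_right[symmetric]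
  by (rule tendsto_mult_left)

lemma has_mean_diff: "has_mean f M \<Longrightarrow> has_mean g N \<Longrightarrow> has_mean (\<lambda>j. f j - g j) (M - N)"
  unfolding has_mean_def by (simp add: sum_subtractf diff_divide_distrib tendsto_diff)

lemma has_mean_sum:
  assumes "\<And>i. i \<in> I \<Longrightarrow> has_mean (f i) (M i)"
  shows "has_mean (\<lambda>j. \<Sum>i\<in>I. f i j) (\<Sum>i\<in>I. M i)"
  using assms
proof (induction I rule: infinite_finite_induct)
  case (insert i I)
  then show ?case by (auto intro!: has_mean_add)
qed (use has_mean_const[of 0] in auto)

lemma has_mean_0_if_tendsto_0:
  assumes "f \<longlonglongrightarrow> 0"
  shows "has_mean f 0"
  unfolding has_mean_def
proof (rule LIMSEQ_I)
  fix \<delta> :: real assume "\<delta> > 0"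
  then obtain J where J: "\<And>j. j \<ge> J \<Longrightarrow> norm (f j) < \<delta> / 2"
    using LIMSEQ_D[OF assms, of "\<delta> / 2"] by auto
  \<comment> \<open>The first \<open>J\<close> terms contribute at most the constant \<open>K\<close>, which division by \<open>n\<close> makes small.\<close>
  define K where "K = (\<Sum>j<J. norm (f j))"
  obtain n0 where n0: "real n0 > 2 * K / \<delta>" using reals_Archimedean2 by blast
  have "norm ((\<Sum>j<n. f j) / of_nat n) < \<delta>" if n: "n \<ge> max 1 n0" for n
  proof -
    have "norm (\<Sum>j<n. f j) \<le> (\<Sum>j<n. norm (f j))" by (rule norm_sum)
    also have "\<dots> \<le> (\<Sum>j<n. (if j < J then norm (f j) else 0) + \<delta> / 2)"
      using J \<open>\<delta> > 0\<close> by (intro sum_mono) (auto simp: less_imp_le)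
    also have "\<dots> = (\<Sum>j\<in>{..<n} \<inter> {..<J}. norm (f j)) + n * (\<delta> / 2)"
      by (simp add: sum.distrib sum.inter_restrict)
    also have "(\<Sum>j\<in>{..<n} \<inter> {..<J}. norm (f j)) \<le> K"
      unfolding K_def by (intro sum_mono2) auto
    also have "K < n * (\<delta> / 2)"
    proof -
      have "2 * K / \<delta> < n" using n n0 by linarith
      then show ?thesis using \<open>\<delta> > 0\<close> by (simp add: field_simps)
    qed
    finally have "norm (\<Sum>j<n. f j) < \<delta> * n" by (simp add: mult.commute)
    then show ?thesis using n by (simp add: norm_divide divide_less_eq)
  qed
  then show "\<exists>no. \<forall>n\<ge>no. norm ((\<Sum>j<n. f j) / of_nat n - 0) < \<delta>"
    by (intro exI[of _ "max 1 n0"]) simp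
qed

lemma has_mean_Re: "has_mean f M \<Longrightarrow> has_mean (\<lambda>j. Re (f j)) (Re M)"
  unfolding has_mean_def by (drule tendsto_Re) simp

lemma has_mean_powers:
  fixes z :: complex
  assumes "norm z = 1"
  shows "has_mean (\<lambda>j. z ^ j) (if z = 1 then 1 else 0)"
proof (cases "z = 1")
  case True
  then show ?thesis using has_mean_const[of 1] by simp
next
  case False
  have "(\<lambda>n. (\<Sum>j<n. z ^ j) / of_nat n) \<longlonglongrightarrow> 0"
  proof (rule Lim_null_comparison)
    show "\<forall>\<^sub>F n in sequentially. norm ((\<Sum>j<n. z ^ j) / of_nat n) \<le> 2 / norm (z - 1) * inverse (real n)"
    proof (rule always_eventually, rule allI)
      fix n
      have "norm (\<Sum>j<n. z ^ j) = norm (z ^ n - 1) / norm (z - 1)"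
        using False by (simp add: geometric_sum norm_divide)
      also have "norm (z ^ n - 1) \<le> 2"
        using norm_triangle_ineq4[of "z ^ n" 1] assms by (simp add: norm_power)
      finally have "norm (\<Sum>j<n. z ^ j) \<le> 2 / norm (z - 1)" by (simp add: divide_right_mono)
      then show "norm ((\<Sum>j<n. z ^ j) / of_nat n) \<le> 2 / norm (z - 1) * inverse (real n)"
        unfolding norm_divide norm_of_nat divide_inverse[of _ "real n"] by (intro mult_right_mono) auto
    qed
    show "(\<lambda>n. 2 / norm (z - 1) * inverse (real n)) \<longlonglongrightarrow> 0"
      by (intro tendsto_mult_right_zero lim_inverse_n)
  qed
  then show ?thesis using False by (simp add: has_mean_def)
qed

text \<open>Averaging along \<open>j\<close> is a Fourier projection: it annihilates every frequency except \<open>1\<close>.\<close>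

lemma has_mean_exponential_sum:
  fixes u :: "'b \<Rightarrow> complex"
  assumes "finite I" "\<And>i. i \<in> I \<Longrightarrow> norm (u i) = 1"
  shows "has_mean (\<lambda>j. \<Sum>i\<in>I. b i * u i ^ j) (\<Sum>i\<in>{i \<in> I. u i = 1}. b i)"
proof -
  have "has_mean (\<lambda>j. \<Sum>i\<in>I. b i * u i ^ j) (\<Sum>i\<in>I. b i * (if u i = 1 then 1 else 0))"
    by (intro has_mean_sum has_mean_cmult has_mean_powers assms)
  also have "(\<Sum>i\<in>I. b i * (if u i = 1 then 1 else 0)) = (\<Sum>i\<in>{i \<in> I. u i = 1}. b i)"
    using assms(1) by (simp add: sum.inter_filter if_distrib cong: if_cong)
  finally show ?thesis .
qed

text \<open>If \<open>y\<close> eventually stays below \<open>M + \<eta>\<close>, then \<open>|y - M| \<le> 2 \<eta> - (y - M)\<close> from then on,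
  and the right-hand side has mean \<open>2 \<eta>\<close>. So the mean absolute deviation is at most \<open>2 \<eta>\<close>, but it
  is at least the modulus of the correlation \<open>C\<close> with a unimodular sequence.\<close>

lemma frequently_above_mean:
  fixes y :: "nat \<Rightarrow> real" and w :: "nat \<Rightarrow> complex"
  assumes "has_mean y M" and C: "has_mean (\<lambda>j. of_real (y j - M) * w j) C"
    and w: "\<And>j. norm (w j) = 1" and \<eta>: "0 \<le> \<eta>" "2 * \<eta> < norm C"
  shows "\<exists>\<^sub>\<infinity>j. M + \<eta> < y j"
proof (rule ccontr)
  assume "\<not> ?thesis"
  then have ev: "\<forall>\<^sub>F j in sequentially. y j \<le> M + \<eta>"
    unfolding not_INFM by (simp add: not_less cofinite_eq_sequentially)
  \<comment> \<open>\<open>h\<close> corrects the finitely many initial terms, so that the bound holds for every \<open>j\<close>.\<close>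
  define h where "h j = max 0 (\<bar>y j - M\<bar> - (2 * \<eta> - (y j - M)))" for j
  have "\<forall>\<^sub>F j in sequentially. h j = 0"
    using ev by eventually_elim (use \<eta> in \<open>auto simp: h_def max_def abs_if\<close>)
  then have "has_mean h 0"
    by (intro has_mean_0_if_tendsto_0 tendsto_eventually)
  then have "has_mean (\<lambda>j. 2 * \<eta> - (y j - M) + h j) (2 * \<eta> - (M - M) + 0)"
    by (intro has_mean_add has_mean_diff has_mean_const assms(1))
  then have bound: "has_mean (\<lambda>j. 2 * \<eta> - (y j - M) + h j) (2 * \<eta>)" by simp
  have "norm C \<le> 2 * \<eta>"
  proof (rule LIMSEQ_le)
    show "(\<lambda>n. norm ((\<Sum>j<n. of_real (y j - M) * w j) / of_nat n)) \<longlonglongrightarrow> norm C"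
      using C unfolding has_mean_def by (rule tendsto_norm)
    show "(\<lambda>n. (\<Sum>j<n. 2 * \<eta> - (y j - M) + h j) / of_nat n) \<longlonglongrightarrow> 2 * \<eta>"
      using bound unfolding has_mean_def .
    have "norm (\<Sum>j<n. of_real (y j - M) * w j) \<le> (\<Sum>j<n. 2 * \<eta> - (y j - M) + h j)" for n
      by (intro sum_norm_le) (simp add: norm_mult w h_def del: of_real_diff)
    then show "\<exists>N. \<forall>n\<ge>N. norm ((\<Sum>j<n. of_real (y j - M) * w j) / of_nat n)
        \<le> (\<Sum>j<n. 2 * \<eta> - (y j - M) + h j) / of_nat n"
      by (simp add: norm_divide divide_right_mono del: of_real_diff)
  qed
  then show False using \<eta> by simp
qed

lemma frequently_below_mean:
  fixes y :: "nat \<Rightarrow> real" and w :: "nat \<Rightarrow> complex"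
  assumes "has_mean y M" and C: "has_mean (\<lambda>j. of_real (y j - M) * w j) C"
    and "\<And>j. norm (w j) = 1" and "0 \<le> \<eta>" "2 * \<eta> < norm C"
  shows "\<exists>\<^sub>\<infinity>j. y j < M - \<eta>"
proof -
  have "\<exists>\<^sub>\<infinity>j. - M + \<eta> < - y j"
  proof (rule frequently_above_mean)
    show "has_mean (\<lambda>j. - y j) (- M)" using has_mean_cmult[OF assms(1), of "-1"] by simp
    show "has_mean (\<lambda>j. of_real (- y j - - M) * w j) (- C)"
      using has_mean_cmult[OF C, of "-1"] by (simp add: algebra_simps)
  qed (use assms in auto)
  then show ?thesis by (rule INFM_mono) simp
qed

section \<open>Roots of unity and simultaneous approximation\<close>

lemma common_exponent_roots_of_unity:
  fixes E :: "'a::comm_monoid_mult set"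
  assumes "finite E" "\<And>z. z \<in> E \<Longrightarrow> \<exists>q>0. z ^ q = 1"
  shows "\<exists>N>0. \<forall>z\<in>E. z ^ N = 1"
  using assms
proof (induction E rule: finite_induct)
  case (insert z E)
  from insert obtain N where "N > 0" "\<forall>z\<in>E. z ^ N = 1" by auto
  moreover from insert.prems[of z] obtain q where "q > 0" "z ^ q = 1" by auto
  moreover have "z ^ (N * q) = (z ^ q) ^ N" by (simp only: power_mult[symmetric] mult.commute)
  ultimately show ?case by (intro exI[of _ "N * q"]) (auto simp: power_mult)
qed auto

text \<open>Dirichlet approximation of the numbers \<open>N0 * Arg z / (2 * pi)\<close>; the factor \<open>N0\<close> forces
  the resulting exponent to be a multiple of \<open>N0\<close>.\<close>

lemma simultaneous_near_1:
  fixes E :: "complex set"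
  assumes "finite E" "\<And>z. z \<in> E \<Longrightarrow> norm z = 1" "N0 > 0" "\<delta> > 0"
  shows "\<exists>N>0. N0 dvd N \<and> (\<forall>z\<in>E. norm (z ^ N - 1) < \<delta>)"
proof -
  obtain f :: "nat \<Rightarrow> complex" where f: "E = f ` {..<card E}"
    using ex_bij_betw_nat_finite[OF assms(1)] by (auto simp: bij_betw_def atLeast0LessThan)
  obtain K :: nat where K: "real K > 2 * pi / \<delta>" using reals_Archimedean2 by blast
  have "0 < 2 * pi / \<delta>" using assms(4) by simp
  with K have "real K > 0" by (rule less_trans[rotated])
  then have "K > 0" by simp
  obtain q p where q: "0 < q"
    and p: "\<forall>i<card E. \<bar>of_int q * (N0 * Arg (f i) / (2 * pi)) - of_int (p i)\<bar> < 1 / K"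
    by (rule Dirichlet_approx_simult[OF \<open>K > 0\<close>, where n = "card E" and \<theta> = "\<lambda>i. N0 * Arg (f i) / (2 * pi)"])
      (rule that, auto)
  define N where "N = N0 * nat q"
  have "norm (f i ^ N - 1) < \<delta>" if i: "i < card E" for i
  proof -
    have "norm (f i) = 1" using assms(2) f i by blast
    then have "f i = cis (Arg (f i))"
      using rcis_cmod_Arg[of "f i"] by (simp add: rcis_def)
    define t where "t = 2 * pi * (of_int q * (N0 * Arg (f i) / (2 * pi)) - of_int (p i))"
    have "f i ^ N = cis (N * Arg (f i))"
      using \<open>f i = cis (Arg (f i))\<close> by (metis Complex.DeMoivre)
    also have "N * Arg (f i) = t + 2 * pi * of_int (p i)"
      using q by (simp add: t_def N_def field_simps)
    also have "cis (t + 2 * pi * of_int (p i)) = cis t * cis (2 * pi * of_int (p i))"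
      by (simp only: cis_mult)
    also have "cis (2 * pi * of_int (p i)) = 1" by (rule cis_multiple_2pi) simp
    also have "cis t * 1 = exp (\<i> * t)" by (simp add: cis_conv_exp)
    finally have "norm (f i ^ N - 1) = 2 * \<bar>sin (t / 2)\<bar>"
      by (simp add: dist_exp_i_1)
    also have "\<dots> \<le> \<bar>t\<bar>" using abs_sin_x_le_abs_x[of "t / 2"] by simp
    also have "\<bar>t\<bar> = 2 * pi * \<bar>of_int q * (N0 * Arg (f i) / (2 * pi)) - of_int (p i)\<bar>"
      unfolding t_def by (simp only: abs_mult) simp
    also have "\<dots> < 2 * pi * (1 / K)"
      using p i by (intro mult_strict_left_mono) auto
    also have "\<dots> < \<delta>" using K \<open>K > 0\<close> assms(4) by (simp add: field_simps)
    finally show ?thesis .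
  qed
  then have "\<forall>z\<in>E. norm (z ^ N - 1) < \<delta>" by (subst f) auto
  moreover have "N > 0" using q assms(3) by (simp add: N_def)
  ultimately show ?thesis by (intro exI[of _ N]) (simp add: N_def)
qed

section \<open>Exponential sums with an infinite order frequency\<close>

text \<open>
  In terms of the closed subgroup of the torus generated by the frequencies, the identity component
  is nontrivial, and the exponential sum is a nonconstant continuous function on some coset
  of this component. The proof below replaces this picture by means along arithmetic progressions.
\<close>

lemma limit_points_exponential_sum_contain_interval:
  fixes x :: "nat \<Rightarrow> real" and E :: "complex set"
  assumes fin: "finite E" and E1: "\<And>z. z \<in> E \<Longrightarrow> norm z = 1" and c0: "\<And>z. z \<in> E \<Longrightarrow> c z \<noteq> 0"
    and x: "(\<lambda>k. of_real (x k) - (\<Sum>z\<in>E. c z * z ^ k)) \<longlonglongrightarrow> 0"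
    and \<nu>: "\<nu> \<in> E" and \<nu>_inf: "\<And>q. q > 0 \<Longrightarrow> \<nu> ^ q \<noteq> 1"
  shows "\<exists>a b. a < b \<and> {a..b} \<subseteq> seq_limit_points x"
proof -
  define s where "s k = (\<Sum>z\<in>E. c z * z ^ k)" for k
  define U where "U = {z \<in> E. \<exists>q>0. z ^ q = 1}"
  define W where "W = {z \<in> E. \<exists>q>0. (z / \<nu>) ^ q = 1}"
  have finUW: "finite U" "finite W" using fin by (auto simp: U_def W_def)
  have E0: "z \<noteq> 0" if "z \<in> E" for z using E1[OF that] by auto
  obtain N1 where N1: "N1 > 0" "\<And>z. z \<in> U \<Longrightarrow> z ^ N1 = 1"
    using common_exponent_roots_of_unity[OF finUW(1)] unfolding U_def by blast
  obtain N2 where N2: "N2 > 0" "\<And>z. z \<in> W \<Longrightarrow> (z / \<nu>) ^ N2 = 1"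
    using common_exponent_roots_of_unity[OF finite_imageI[OF finUW(2)], of "\<lambda>z. z / \<nu>"]
    unfolding W_def by blast
  \<comment> \<open>For multiples \<open>N\<close> of \<open>N0\<close>, raising to the power \<open>N\<close> trivialises all torsion among the
     frequencies and their quotients by \<open>\<nu>\<close>. This makes the means below independent of \<open>N\<close>.\<close>
  define N0 where "N0 = N1 * N2"
  have "N0 > 0" using N1 N2 by (simp add: N0_def)
  have U_iff: "z ^ N = 1 \<longleftrightarrow> z \<in> U" if "z \<in> E" "N0 dvd N" "N > 0" for z N
  proof
    assume "z \<in> U"
    obtain d where "N = N1 * N2 * d" using \<open>N0 dvd N\<close> unfolding N0_def by (elim dvdE)
    then have "N = N1 * (N2 * d)" by (simp only: mult.assoc)
    then show "z ^ N = 1" using N1(2)[OF \<open>z \<in> U\<close>] by (simp only: power_mult power_one)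
  qed (use that in \<open>auto simp: U_def\<close>)
  have W_iff: "(z / \<nu>) ^ N = 1 \<longleftrightarrow> z \<in> W" if "z \<in> E" "N0 dvd N" "N > 0" for z N
  proof
    assume "z \<in> W"
    obtain d where "N = N1 * N2 * d" using \<open>N0 dvd N\<close> unfolding N0_def by (elim dvdE)
    then have "N = N2 * (N1 * d)" by (simp only: mult_ac)
    then show "(z / \<nu>) ^ N = 1" using N2(2)[OF \<open>z \<in> W\<close>] by (simp only: power_mult power_one)
  qed (use that in \<open>auto simp: W_def\<close>)
  have "\<nu> \<in> W" using \<nu> E0 by (auto simp: W_def)
  \<comment> \<open>The offset of the progressions: terms whose frequencies have the same \<open>N\<close>-th power as \<open>\<nu>\<close>
     must not cancel.\<close>
  have "\<exists>a. (\<Sum>z\<in>W. c z * z ^ a) \<noteq> 0"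
    using power_sum_eq_0_imp_coeff_0[of W c, OF _ _ \<open>\<nu> \<in> W\<close>] finUW c0[OF \<nu>] by blast
  then obtain a where a: "(\<Sum>z\<in>W. c z * z ^ a) \<noteq> 0" by blast
  define C where "C = (\<Sum>z\<in>W. c z * z ^ a)"
  define M where "M = Re (\<Sum>z\<in>U. c z * z ^ a)"
  define \<eta> where "\<eta> = norm C / 3"
  have "C \<noteq> 0" using a by (simp add: C_def)
  then have \<eta>: "\<eta> > 0" "2 * \<eta> < norm C" by (auto simp: \<eta>_def)
  have prog: "(\<exists>\<^sub>\<infinity>j. M + \<eta> < x (a + N * j)) \<and> (\<exists>\<^sub>\<infinity>j. x (a + N * j) < M - \<eta>)"
    if N: "N0 dvd N" "N > 0" for N
  proof -
    let ?y = "\<lambda>j. x (a + N * j)"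
    have "strict_mono (\<lambda>j. a + N * j)" using N(2) by (auto intro: strict_monoI)
    from LIMSEQ_subseq_LIMSEQ[OF x this]
    have err: "(\<lambda>j. of_real (?y j) - s (a + N * j)) \<longlonglongrightarrow> 0" by (simp add: o_def s_def)
    have s: "s (a + N * j) = (\<Sum>z\<in>E. (c z * z ^ a) * (z ^ N) ^ j)" for j
      by (simp add: s_def power_add power_mult mult_ac)
    have "has_mean (\<lambda>j. (\<Sum>z\<in>E. (c z * z ^ a) * (z ^ N) ^ j)) (\<Sum>z\<in>{z\<in>E. z ^ N = 1}. c z * z ^ a)"
      by (intro has_mean_exponential_sum) (auto simp: fin norm_power E1)
    also have "{z\<in>E. z ^ N = 1} = U" using U_iff N by (auto simp: U_def)
    finally have "has_mean (\<lambda>j. s (a + N * j)) (\<Sum>z\<in>U. c z * z ^ a)" by (simp add: s)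
    from has_mean_Re[OF has_mean_add[OF this has_mean_0_if_tendsto_0[OF err]]]
    have mean: "has_mean ?y M" by (simp add: M_def)
    \<comment> \<open>Multiplication by \<open>w\<close> shifts the frequency \<open>\<nu>\<^sup>N\<close> to \<open>1\<close>, so its coefficient appears as a mean.\<close>
    define w where "w j = inverse (\<nu> ^ N) ^ j" for j
    have w1: "norm (w j) = 1" for j by (simp add: w_def norm_power norm_inverse E1 \<nu>)
    have "has_mean (\<lambda>j. (\<Sum>z\<in>E. (c z * z ^ a) * ((z / \<nu>) ^ N) ^ j)) (\<Sum>z\<in>{z\<in>E. (z / \<nu>) ^ N = 1}. c z * z ^ a)"
      by (intro has_mean_exponential_sum) (auto simp: fin norm_power norm_divide E1 \<nu>)
    also have "{z\<in>E. (z / \<nu>) ^ N = 1} = W" using W_iff N by (auto simp: W_def)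
    also have "(\<lambda>j. (\<Sum>z\<in>E. (c z * z ^ a) * ((z / \<nu>) ^ N) ^ j)) = (\<lambda>j. s (a + N * j) * w j)"
      unfolding s w_def sum_distrib_right
      by (intro ext sum.cong refl) (simp add: divide_inverse power_mult_distrib power_inverse)
    finally have "has_mean (\<lambda>j. s (a + N * j) * w j) C" by (simp add: C_def)
    moreover have "has_mean (\<lambda>j. (of_real (?y j) - s (a + N * j)) * w j) 0"
    proof (rule has_mean_0_if_tendsto_0, rule tendsto_norm_zero_cancel)
      show "(\<lambda>j. norm ((of_real (?y j) - s (a + N * j)) * w j)) \<longlonglongrightarrow> 0"
        using tendsto_norm_zero[OF err] by (simp add: norm_mult w1)
    qed
    moreover have "has_mean (\<lambda>j. of_real M * w j) (of_real M * 0)"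
    proof (rule has_mean_cmult)
      have "inverse (\<nu> ^ N) \<noteq> 1" using \<nu>_inf[OF N(2)] by simp
      moreover have "norm (inverse (\<nu> ^ N)) = 1" by (simp add: norm_power norm_inverse E1 \<nu>)
      ultimately show "has_mean w 0" using has_mean_powers[of "inverse (\<nu> ^ N)"] by (simp add: w_def[abs_def])
    qed
    ultimately have "has_mean (\<lambda>j. (s (a + N * j) * w j + (of_real (?y j) - s (a + N * j)) * w j) - of_real M * w j) ((C + 0) - of_real M * 0)"
      by (intro has_mean_diff has_mean_add)
    then have "has_mean (\<lambda>j. of_real (?y j - M) * w j) C"
      by (simp add: algebra_simps)
    with mean w1 \<eta> show ?thesis
      using frequently_above_mean[of ?y M w C \<eta>] frequently_below_mean[of ?y M w C \<eta>] by simp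
  qed
  have "e \<in> seq_limit_points x" if e: "M - \<eta> \<le> e" "e \<le> M + \<eta>" for e
  proof (rule seq_limit_points_I)
    fix \<delta> :: real assume "\<delta> > 0"
    define B where "B = (\<Sum>z\<in>E. norm (c z)) + 1"
    have B: "B > 0" by (simp add: B_def add_nonneg_pos sum_nonneg)
    obtain N where N: "N > 0" "N0 dvd N" "\<And>z. z \<in> E \<Longrightarrow> norm (z ^ N - 1) < \<delta> / (2 * B)"
      using simultaneous_near_1[OF fin E1 \<open>N0 > 0\<close>, of "\<delta> / (2 * B)"] B \<open>\<delta> > 0\<close> by auto
    let ?y = "\<lambda>j. x (a + N * j)"
    have s_step: "norm (s (k + N) - s k) \<le> \<delta> / 2" for k
    proof -
      have "s (k + N) - s k = (\<Sum>z\<in>E. c z * z ^ k * (z ^ N - 1))"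
        by (simp add: s_def sum_subtractf[symmetric] power_add algebra_simps)
      also have "norm \<dots> \<le> (\<Sum>z\<in>E. norm (c z) * (\<delta> / (2 * B)))"
      proof (rule sum_norm_le)
        fix z assume "z \<in> E"
        then show "norm (c z * z ^ k * (z ^ N - 1)) \<le> norm (c z) * (\<delta> / (2 * B))"
          using mult_left_mono[OF less_imp_le[OF N(3)], of z "norm (c z)"]
          by (simp add: norm_mult norm_power E1)
      qed
      also have "\<dots> \<le> B * (\<delta> / (2 * B))"
        unfolding sum_distrib_right[symmetric] using B \<open>\<delta> > 0\<close>
        by (intro mult_right_mono) (auto simp: B_def)
      also have "\<dots> = \<delta> / 2" using B by simp
      finally show ?thesis .
    qed
    have "(\<lambda>k. (of_real (x (k + N)) - s (k + N)) - (of_real (x k) - s k)) \<longlonglongrightarrow> 0"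
      using tendsto_diff[OF LIMSEQ_ignore_initial_segment[OF x, of N] x] by (simp add: s_def)
    then have "\<forall>\<^sub>F k in sequentially. norm ((of_real (x (k + N)) - s (k + N)) - (of_real (x k) - s k)) < \<delta> / 2"
      using \<open>\<delta> > 0\<close> by (auto dest!: tendstoD[of _ _ _ "\<delta> / 2"])
    then have "\<forall>\<^sub>F k in sequentially. \<bar>x (k + N) - x k\<bar> < \<delta>"
    proof eventually_elim
      case (elim k)
      have "\<bar>x (k + N) - x k\<bar> = norm (complex_of_real (x (k + N)) - of_real (x k))"
        by (metis norm_of_real of_real_diff)
      also have "\<dots> = norm (((of_real (x (k + N)) - s (k + N)) - (of_real (x k) - s k)) + (s (k + N) - s k))"
        by simp
      also have "\<dots> < \<delta> / 2 + \<delta> / 2"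
        by (intro norm_triangle_lt add_less_le_mono elim s_step)
      finally show ?case by simp
    qed
    then obtain J where J: "\<And>k. k \<ge> J \<Longrightarrow> \<bar>x (k + N) - x k\<bar> < \<delta>"
      unfolding eventually_sequentially by blast
    have ge: "j \<le> a + N * j" for j using N(1) by (cases N) auto
    have "\<forall>\<^sub>F j in sequentially. \<bar>?y (Suc j) - ?y j\<bar> < \<delta>"
      unfolding eventually_sequentially
    proof (intro exI[of _ J] allI impI)
      fix j assume "J \<le> j"
      then show "\<bar>?y (Suc j) - ?y j\<bar> < \<delta>"
        using J[of "a + N * j"] ge[of j] by (simp add: algebra_simps)
    qed
    moreover have "\<exists>\<^sub>\<infinity>j. e < ?y j"
      by (rule INFM_mono[OF conjunct1[OF prog[OF N(2,1)]]]) (use e in linarith)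
    moreover have "\<exists>\<^sub>\<infinity>j. ?y j < e"
      by (rule INFM_mono[OF conjunct2[OF prog[OF N(2,1)]]]) (use e in linarith)
    ultimately have "\<exists>\<^sub>\<infinity>j. \<bar>?y j - e\<bar> < \<delta>" by (intro crossing_frequently_near)
    then show "\<exists>\<^sub>\<infinity>k. dist (x k) e < \<delta>"
      unfolding INFM_nat dist_real_def using ge by (meson less_le_trans)
  qed
  then show ?thesis using \<eta> by (intro exI[of _ "M - \<eta>"] exI[of _ "M + \<eta>"]) auto
qed

section \<open>The Reidemeister coincidence zeta function\<close>

lemma reidemeister_number_pos:
  assumes "group G" "tame_pair G \<phi> \<psi>" "k \<ge> 1"
  shows "reidemeister_number G (\<phi> ^^ k) (\<psi> ^^ k) > 0"
proof -
  have "carrier G \<noteq> {}"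
    using group.is_monoid[OF assms(1)] monoid.one_closed by blast
  then have "reidemeister_classes G (\<phi> ^^ k) (\<psi> ^^ k) \<noteq> {}"
    by (auto simp: reidemeister_classes_def quotient_def)
  then show ?thesis
    using assms(2,3) by (simp add: tame_pair_def reidemeister_number_def card_gt_0_iff)
qed

text \<open>The set \<open>reidemeister_lambdas\<close> is given by a definite description; existence and uniqueness
  of the expansion show that it denotes what it should. Nonemptiness holds because Reidemeister
  numbers are positive.\<close>

lemma reidemeister_expansion_lambdas:
  assumes "group G" and tame: "tame_pair G \<phi> \<psi>" and rat: "rational_fps (reidemeister_zeta G \<phi> \<psi>)"
  shows "\<exists>m. reidemeister_expansion G \<phi> \<psi> (reidemeister_lambdas G \<phi> \<psi>) m"
proof -
  let ?R = "\<lambda>k. reidemeister_number G (\<phi> ^^ k) (\<psi> ^^ k)"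
  have "int_power_sum (\<lambda>k. of_nat (?R (Suc k)) :: complex)"
    using rational_exp_int_power_sum[of "\<lambda>k. of_nat (?R k)"] rat unfolding reidemeister_zeta_def by blast
  then obtain L :: "complex set" and m where fin: "finite L" and nz: "\<And>l. l \<in> L \<Longrightarrow> l \<noteq> 0 \<and> m l \<noteq> 0"
    and sum: "\<And>k. of_nat (?R (Suc k)) = (\<Sum>l\<in>L. of_int (m l) * l ^ Suc k)"
    unfolding int_power_sum_def by blast
  have sum': "of_nat (?R k) = (\<Sum>l\<in>L. of_int (m l) * l ^ k)" if "k \<ge> 1" for k
    using sum[of "k - 1"] that by simp
  have "L \<noteq> {}"
    using sum'[of 1] reidemeister_number_pos[OF assms(1) tame, of 1] by auto
  moreover have "algebraic_int l" if "l \<in> L" for l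
  proof (rule algebraic_int_if_power_sums_int[OF fin _ _ that])
    fix k
    have "(\<Sum>z\<in>L. of_int (m z) * z * z ^ k) = of_nat (?R (Suc k))"
      unfolding sum by (simp add: mult_ac)
    then show "(\<Sum>z\<in>L. of_int (m z) * z * z ^ k) \<in> \<int>" by simp
  qed (use nz in simp)
  ultimately have L: "reidemeister_expansion G \<phi> \<psi> L m"
    using fin nz sum' unfolding reidemeister_expansion_def by blast
  have uniq: "M = L" if "reidemeister_expansion G \<phi> \<psi> M m'" for M m'
    using that L unfolding reidemeister_expansion_def
    by (intro power_sum_unique[of M L m' m]) auto
  have "reidemeister_lambdas G \<phi> \<psi> = L"
    unfolding reidemeister_lambdas_def using L uniq by (intro the_equality) blast+
  then show ?thesis using L by blast
qed

theorem theorem26: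
  fixes G :: "('a, 'b) monoid_scheme" and \<phi> \<psi> :: "'a \<Rightarrow> 'a"
  assumes "nilpotent_group G"
    and "torsion_free G"
    and "finite_pruefer_rank G"
    and "\<phi> \<in> hom G G" and "\<psi> \<in> hom G G"
    and "tame_pair G \<phi> \<psi>"
    and "rational_fps (reidemeister_zeta G \<phi> \<psi>)"
  shows "(\<exists>(\<alpha> :: nat \<Rightarrow> int) (\<epsilon> :: nat \<Rightarrow> complex) (q :: nat).
            q > 0 \<and> (\<forall>j\<in>{1..lambda_max_count G \<phi> \<psi>}. \<epsilon> j ^ q = 1) \<and>
            seq_limit_points (\<lambda>k. complex_of_real (reidemeister_ratio G \<phi> \<psi> k)) =
            seq_limit_points (\<lambda>k. \<Sum>j = 1..lambda_max_count G \<phi> \<psi>. of_int (\<alpha> j) * \<epsilon> j ^ Suc k))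
       \<or> (\<exists>a b :: real. a < b \<and> {a..b} \<subseteq> seq_limit_points (reidemeister_ratio G \<phi> \<psi>))"
proof -
  define L where "L = reidemeister_lambdas G \<phi> \<psi>"
  define \<rho> where "\<rho> = lambda_max G \<phi> \<psi>"
  define D where "D = {l \<in> L. cmod l = \<rho>}"
  let ?n = "lambda_max_count G \<phi> \<psi>" and ?x = "reidemeister_ratio G \<phi> \<psi>"
  have "group G" using assms(1) by (simp add: nilpotent_group_def)
  then obtain m where "reidemeister_expansion G \<phi> \<psi> L m"
    using reidemeister_expansion_lambdas assms(6,7) unfolding L_def by blast
  then have L: "finite L" "L \<noteq> {}" "\<And>l. l \<in> L \<Longrightarrow> l \<noteq> 0 \<and> m l \<noteq> 0"
    and sum: "\<And>k. k \<ge> 1 \<Longrightarrow> of_nat (reidemeister_number G (\<phi> ^^ k) (\<psi> ^^ k)) = (\<Sum>l\<in>L. of_int (m l) * l ^ k)"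
    unfolding reidemeister_expansion_def by blast+
  have \<rho>_Max: "\<rho> = Max (cmod ` L)" by (simp add: \<rho>_def lambda_max_def L_def)
  then have le: "cmod l \<le> \<rho>" if "l \<in> L" for l using that L(1) by simp
  have "\<rho> \<in> cmod ` L" unfolding \<rho>_Max using L(1,2) by (intro Max_in) auto
  then have \<rho>: "\<rho> > 0" using L(3) by auto
  have D: "finite D" "D \<subseteq> L" using L(1) by (auto simp: D_def)
  have n: "?n = card D" by (simp add: lambda_max_count_def D_def L_def \<rho>_def)
  have x: "complex_of_real (?x k) = (\<Sum>l\<in>L. of_int (m l) * (l / \<rho>) ^ Suc k)" for k
  proof -
    have "complex_of_real (?x k) = (\<Sum>l\<in>L. of_int (m l) * l ^ Suc k) / of_real \<rho> ^ Suc k"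
      using sum[of "Suc k"] by (simp add: reidemeister_ratio_def \<rho>_def)
    then show ?thesis by (simp add: sum_divide_distrib power_divide del: power_Suc)
  qed
  have dominant: "(\<lambda>k. complex_of_real (?x k) - (\<Sum>l\<in>D. of_int (m l) * (l / \<rho>) ^ Suc k)) \<longlonglongrightarrow> 0"
  proof -
    have "(\<lambda>k. \<Sum>l\<in>L - D. of_int (m l) * (l / \<rho>) ^ Suc k) \<longlonglongrightarrow> (\<Sum>l\<in>L - D. of_int (m l) * 0)"
    proof (intro tendsto_sum tendsto_mult tendsto_const LIMSEQ_Suc LIMSEQ_power_zero)
      fix l assume "l \<in> L - D"
      then have "cmod l < \<rho>" using le[of l] by (simp add: D_def order.strict_iff_order)
      then show "norm (l / \<rho>) < 1" using \<rho> by (simp add: norm_divide)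
    qed
    then show ?thesis
      unfolding x sum.subset_diff[OF D(2) L(1)] by simp
  qed
  show ?thesis
  proof (cases "\<forall>l\<in>D. \<exists>q>0. (l / \<rho>) ^ q = 1")
    case True
    then obtain q where q: "q > 0" "\<And>l. l \<in> D \<Longrightarrow> (l / \<rho>) ^ q = 1"
      using common_exponent_roots_of_unity[OF finite_imageI[OF D(1)], of "\<lambda>l. l / \<rho>"] by blast
    obtain f where f: "bij_betw f {1..?n} D"
      using ex_bij_betw_nat_finite_1[OF D(1)] n by auto
    have "(\<Sum>l\<in>D. of_int (m l) * (l / \<rho>) ^ Suc k) = (\<Sum>j=1..?n. of_int (m (f j)) * (f j / \<rho>) ^ Suc k)" for k
      by (rule sum.reindex_bij_betw[OF f, symmetric])
    then have "seq_limit_points (\<lambda>k. complex_of_real (?x k))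
        = seq_limit_points (\<lambda>k. \<Sum>j=1..?n. of_int (m (f j)) * (f j / \<rho>) ^ Suc k)"
      using seq_limit_points_cong[OF dominant] by simp
    moreover have "\<forall>j\<in>{1..?n}. (f j / \<rho>) ^ q = 1"
      using q(2) bij_betwE[OF f] by blast
    ultimately show ?thesis
      using q(1) by (intro disjI1 exI[of _ "\<lambda>j. m (f j)"] exI[of _ "\<lambda>j. f j / \<rho>"] exI[of _ q]) blast
  next
    case False
    then obtain l0 where l0: "l0 \<in> D" "\<And>q. q > 0 \<Longrightarrow> (l0 / \<rho>) ^ q \<noteq> 1" by blast
    define E where "E = (\<lambda>l. l / complex_of_real \<rho>) ` D"
    \<comment> \<open>The normalised sequence starts at \<open>k = 1\<close>; the extra factor \<open>z\<close> accounts for this.\<close>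
    define c where "c z = of_int (m (z * \<rho>)) * z" for z :: complex
    have "\<exists>a b. a < b \<and> {a..b} \<subseteq> seq_limit_points ?x"
    proof (rule limit_points_exponential_sum_contain_interval[where E = E and c = c and \<nu> = "l0 / \<rho>"])
      show "norm z = 1" if "z \<in> E" for z
        using that \<rho> by (auto simp: E_def D_def norm_divide)
      show "c z \<noteq> 0" if "z \<in> E" for z
        using that \<rho> L(3) by (auto simp: E_def D_def c_def)
      have "inj_on (\<lambda>l. l / complex_of_real \<rho>) D" using \<rho> by (auto intro!: inj_onI)
      then have "(\<Sum>z\<in>E. c z * z ^ k) = (\<Sum>l\<in>D. of_int (m l) * (l / \<rho>) ^ Suc k)" for k
        unfolding E_def using \<rho> by (simp add: sum.reindex c_def mult_ac)
      then show "(\<lambda>k. of_real (?x k) - (\<Sum>z\<in>E. c z * z ^ k)) \<longlonglongrightarrow> 0"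
        using dominant by simp
    qed (use l0 D in \<open>auto simp: E_def\<close>)
    then show ?thesis by blast
  qed
qed

end
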